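(* Let $\mathcal{D}\subseteq\mathbb{R}^n$ be open, let $x\in\mathcal{D}$, let $v\colon\mathcal{D}\to\mathbb{R}^n$ be continuous, and let $h_1,\ldots,h_p\colon\mathcal{D}\to\mathbb{R}$ be continuously differentiable. Let $\Phi\in\mathcal{F}_p$, and define $h(x)\triangleq\Phi(h_1(x),\ldots,h_p(x))$. Then the dual-algebraic evaluation $\Phi_{\mathbb{D}}$ satisfies $$\Phi_{\mathbb{D}}\big(\tilde h_1(x_{\mathbb{D},v}),\ldots,\tilde h_p(x_{\mathbb{D},v})\big)=h(x)+L_vh_{i_*(x)}(x)\,\epsilon,$$ where the index $i_*(x)\in\{1,\ldots,p\}$ is determined by the path through the recursive structure of $\Phi_{\mathbb{D}}$ that, at every $\min_\Re$ node, retains the operand with the smaller real part (breaking ties by left-to-right precedence), and, at every $\max_\Re$ node, retains the operand with the larger real part (with ties resolved as in the definition of $\max_\Re$). Moreover, with $\mathcal{A}(x)\triangleq\{i\in\{1,\ldots,p\}:h_i(x)=h(x)\}$, $$\nabla h_{i_*(x)}(x)\in\mathrm{co}\{\nabla h_i(x):i\in\mathcal{A}(x)\}\supseteq\partial h(x),$$ and, if $\Phi$ is composed of $\min$ operations only, or of $\max$ operations only, then $\nabla h_{i_*(x)}(x)\in\partial h(x)$.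
   Context: The class $\mathcal{F}_p$ of finite composite functions $\mathbb{R}^p\to\mathbb{R}$ is defined inductively: each coordinate projection $\pi_i(y)\triangleq y_{(i)}$, $i\in\{1,\ldots,p\}$, belongs to $\mathcal{F}_p$; and if $\Phi_1,\Phi_2\in\mathcal{F}_p$ then $\min(\Phi_1,\Phi_2)\in\mathcal{F}_p$ and $\max(\Phi_1,\Phi_2)\in\mathcal{F}_p$. An element $\Phi$ is taken together with its inductive construction (a finite expression tree), since the recursion below is structural. Dual numbers: $\mathbb{D}\triangleq\mathbb{R}[\epsilon]/(\epsilon^2)$; $\Re(a+b\epsilon)\triangleq a$. $\min_\Re(z_1,z_2)\triangleq z_1$ if $\Re(z_1)\le\Re(z_2)$, else $z_2$; $\max_\Re(z_1,z_2)\triangleq z_1$ if $\Re(z_1)\ge\Re(z_2)$, else $z_2$. The dual-algebraic evaluation $\Phi_{\mathbb{D}}\colon\mathbb{D}^p\to\mathbb{D}$ is defined by: $\Phi_{\mathbb{D}}(z)\triangleq z_{(i)}$ if $\Phi=\pi_i$; $\Phi_{\mathbb{D}}(z)\triangleq\min_\Re(\Phi_{1,\mathbb{D}}(z),\Phi_{2,\mathbb{D}}(z))$ if $\Phi=\min(\Phi_1,\Phi_2)$; $\Phi_{\mathbb{D}}(z)\triangleq\max_\Re(\Phi_{1,\mathbb{D}}(z),\Phi_{2,\mathbb{D}}(z))$ if $\Phi=\max(\Phi_1,\Phi_2)$. Accordingly, the selected index is $i$ for $\Phi=\pi_i$, and for a $\min$ or $\max$ node is the selected index of the retained operand. For a vector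 field $v$, $x_{\mathbb{D},v}\triangleq x+v(x)\epsilon\in\mathbb{D}^n$; for continuously differentiable $\eta\colon\mathcal{D}\to\mathbb{R}$, $\tilde\eta(x+w\epsilon)\triangleq\eta(x)+\nabla\eta(x)w\,\epsilon$ and $L_v\eta(x)\triangleq\nabla\eta(x)v(x)$. Gradients are row vectors identified with elements of $\mathbb{R}^n$; $\mathrm{co}$ denotes closed convex hull. For locally Lipschitz $h\colon\mathcal{D}\to\mathbb{R}$ with $\Omega_h$ the null set where $\nabla h$ is undefined, the Clarke generalized gradient is $\partial h(x)\triangleq\mathrm{co}\{w\in\mathbb{R}^n:\exists(x_k)\subset\mathcal{D}\setminus\Omega_h,\ x_k\to x,\ \nabla h(x_k)\to w\}$. *)

theory Defs
  imports "HOL-Analysis.Analysis"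
begin

section \<open>Dual numbers\<close>

codatatype dual = Dual (re_part: real) (eps_part: real)

lemma dual_eq_iff: "z = w \<longleftrightarrow> re_part z = re_part w \<and> eps_part z = eps_part w"
  by (auto intro: dual.expand)

instantiation dual :: comm_ring_1
begin

primcorec zero_dual where
  "re_part 0 = 0"
| "eps_part 0 = 0"

primcorec one_dual where
  "re_part 1 = 1"
| "eps_part 1 = 0"

primcorec plus_dual where
  "re_part (z + w) = re_part z + re_part w"
| "eps_part (z + w) = eps_part z + eps_part w"

primcorec uminus_dual where
  "re_part (- z) = - re_part z"
| "eps_part (- z) = - eps_part z"

primcorec minus_dual where
  "re_part (z - w) = re_part z - re_part w"
| "eps_part (z - w) = eps_part z - eps_part w"

primcorec times_dual where
  "re_part (z * w) = re_part z * re_part w"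
| "eps_part (z * w) = re_part z * eps_part w + eps_part z * re_part w"

instance
  by standard (simp_all add: dual_eq_iff algebra_simps)

end

instantiation dual :: real_algebra_1
begin

primcorec scaleR_dual where
  "re_part (scaleR r z) = r * re_part z"
| "eps_part (scaleR r z) = r * eps_part z"

instance
  by standard (simp_all add: dual_eq_iff algebra_simps)

end

definition eps :: dual where
  "eps = Dual 0 1"

lemma re_part_of_real [simp]: "re_part (of_real a) = a"
  and eps_part_of_real [simp]: "eps_part (of_real a) = 0"
  by (simp_all add: of_real_def)

lemma re_part_eps [simp]: "re_part eps = 0"
  and eps_part_eps [simp]: "eps_part eps = 1"
  by (simp_all add: eps_def)

lemma Dual_eq: "Dual a b = of_real a + of_real b * eps"
  by (simp add: dual_eq_iff)

text \<open>
  Evaluation at \<open>eps\<close> is a surjective ring homomorphism from the real polynomials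
  whose kernel is the ideal generated by the square of the indeterminate, so \<open>dual\<close> is
  the corresponding quotient ring.
\<close>

lemma poly_eps_parts:
  "re_part (poly (map_poly of_real p) eps) = coeff p 0"
  "eps_part (poly (map_poly of_real p) eps) = coeff p 1"
proof (induction p)
  case 0
  { case 1 show ?case by simp }
  { case 2 show ?case by simp }
next
  case (pCons a p)
  have *: "map_poly of_real (pCons a p) = pCons (of_real a :: dual) (map_poly of_real p)"
    using pCons.hyps by (simp add: map_poly_pCons)
  { case 1 show ?case by (simp add: *) }
  { case 2 show ?case by (simp add: * pCons.IH) }
qed

lemma dual_polynomial_quotient:
  fixes \<phi> :: "real poly \<Rightarrow> dual"
  defines "\<phi> \<equiv> (\<lambda>p. poly (map_poly of_real p) eps)"
  shows "\<phi> 1 = 1" "\<phi> (p + q) = \<phi> p + \<phi> q" "\<phi> (p * q) = \<phi> p * \<phi> q"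
    and "surj \<phi>" "\<phi> p = 0 \<longleftrightarrow> [:0, 0, 1:] dvd p"
proof -
  show "\<phi> 1 = 1" "\<phi> (p + q) = \<phi> p + \<phi> q"
    by (simp_all add: \<phi>_def dual_eq_iff poly_eps_parts)
  show "\<phi> (p * q) = \<phi> p * \<phi> q"
    by (simp add: \<phi>_def dual_eq_iff poly_eps_parts coeff_mult)
  have "z = \<phi> [:re_part z, eps_part z:]" for z
    by (simp add: \<phi>_def dual_eq_iff poly_eps_parts)
  then show "surj \<phi>" by (rule surjI[OF sym])
  have "monom 1 2 dvd p \<longleftrightarrow> (\<forall>k<2. coeff p k = 0)"
    by (rule monom_1_dvd_iff')
  moreover have "monom (1::real) 2 = [:0, 0, 1:]"
    by (simp add: numeral_2_eq_2 monom_Suc)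
  ultimately show "\<phi> p = 0 \<longleftrightarrow> [:0, 0, 1:] dvd p"
    by (auto simp: \<phi>_def dual_eq_iff poly_eps_parts less_2_cases_iff)
qed

definition min_re :: "dual \<Rightarrow> dual \<Rightarrow> dual" where
  "min_re z w = (if re_part z \<le> re_part w then z else w)"

definition max_re :: "dual \<Rightarrow> dual \<Rightarrow> dual" where
  "max_re z w = (if re_part z \<ge> re_part w then z else w)"


section \<open>Finite composite functions\<close>

text \<open>
  The finite type \<open>'p\<close> is the index set, and an element of the class is represented by
  its expression tree.
\<close>

datatype 'p fcomp = Proj 'p | MinNode "'p fcomp" "'p fcomp" | MaxNode "'p fcomp" "'p fcomp"

primrec fcomp_eval :: "'p::finite fcomp \<Rightarrow> real ^ 'p \<Rightarrow> real" where
  "fcomp_eval (Proj i) y = y $ i"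
| "fcomp_eval (MinNode \<Phi> \<Psi>) y = min (fcomp_eval \<Phi> y) (fcomp_eval \<Psi> y)"
| "fcomp_eval (MaxNode \<Phi> \<Psi>) y = max (fcomp_eval \<Phi> y) (fcomp_eval \<Psi> y)"

primrec dual_eval :: "'p::finite fcomp \<Rightarrow> dual ^ 'p \<Rightarrow> dual" where
  "dual_eval (Proj i) z = z $ i"
| "dual_eval (MinNode \<Phi> \<Psi>) z = min_re (dual_eval \<Phi> z) (dual_eval \<Psi> z)"
| "dual_eval (MaxNode \<Phi> \<Psi>) z = max_re (dual_eval \<Phi> z) (dual_eval \<Psi> z)"

text \<open>The tests are those of \<open>min_re\<close> and \<open>max_re\<close>, so ties go to the left operand.\<close>

primrec selected_index :: "'p::finite fcomp \<Rightarrow> dual ^ 'p \<Rightarrow> 'p" where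
  "selected_index (Proj i) z = i"
| "selected_index (MinNode \<Phi> \<Psi>) z =
     (if re_part (dual_eval \<Phi> z) \<le> re_part (dual_eval \<Psi> z)
      then selected_index \<Phi> z else selected_index \<Psi> z)"
| "selected_index (MaxNode \<Phi> \<Psi>) z =
     (if re_part (dual_eval \<Phi> z) \<ge> re_part (dual_eval \<Psi> z)
      then selected_index \<Phi> z else selected_index \<Psi> z)"

primrec min_only :: "'p fcomp \<Rightarrow> bool" where
  "min_only (Proj i) \<longleftrightarrow> True"
| "min_only (MinNode \<Phi> \<Psi>) \<longleftrightarrow> min_only \<Phi> \<and> min_only \<Psi>"
| "min_only (MaxNode \<Phi> \<Psi>) \<longleftrightarrow> False"

primrec max_only :: "'p fcomp \<Rightarrow> bool" where
  "max_only (Proj i) \<longleftrightarrow> True"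
| "max_only (MinNode \<Phi> \<Psi>) \<longleftrightarrow> False"
| "max_only (MaxNode \<Phi> \<Psi>) \<longleftrightarrow> max_only \<Phi> \<and> max_only \<Psi>"


section \<open>Gradients and dual lifts\<close>

text \<open>
  Functions on an open domain are total functions, of which only the values on the domain
  matter. The gradient is unspecified at points of non-differentiability.
\<close>

definition grad :: "('a::euclidean_space \<Rightarrow> real) \<Rightarrow> 'a \<Rightarrow> 'a" where
  "grad f x = (THE d. GDERIV f x :> d)"

lemma GDERIV_imp_grad: "GDERIV f x :> d \<Longrightarrow> grad f x = d"
  unfolding grad_def gderiv_def
proof (rule the_equality)
  fix e assume "(f has_derivative (\<lambda>h. h \<bullet> d)) (at x)" "(f has_derivative (\<lambda>h. h \<bullet> e)) (at x)"
  then have "(\<lambda>h. h \<bullet> d) = (\<lambda>h. h \<bullet> e)"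
    by (rule has_derivative_unique)
  then show "e = d"
    by (metis vector_eq_ldot)
qed

lemma differentiable_imp_GDERIV_grad:
  fixes f :: "'a::euclidean_space \<Rightarrow> real"
  assumes "f differentiable at x"
  shows "GDERIV f x :> grad f x"
proof -
  obtain f' where f': "(f has_derivative f') (at x)"
    using assms by (auto simp: differentiable_def)
  then interpret f': linear f' by (rule has_derivative_linear)
  have "f' = (\<lambda>h. h \<bullet> (\<Sum>b\<in>Basis. f' b *\<^sub>R b))"
  proof
    fix h
    have "f' h = f' (\<Sum>b\<in>Basis. (h \<bullet> b) *\<^sub>R b)"
      by (simp add: euclidean_representation)
    also have "\<dots> = h \<bullet> (\<Sum>b\<in>Basis. f' b *\<^sub>R b)"
      by (simp add: f'.sum f'.scale inner_sum_right mult.commute)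
    finally show "f' h = h \<bullet> (\<Sum>b\<in>Basis. f' b *\<^sub>R b)" .
  qed
  with f' have "GDERIV f x :> (\<Sum>b\<in>Basis. f' b *\<^sub>R b)"
    by (simp add: gderiv_def)
  then show ?thesis
    using GDERIV_imp_grad by metis
qed

definition continuously_differentiable_on ::
  "'a::euclidean_space set \<Rightarrow> ('a \<Rightarrow> real) \<Rightarrow> bool" where
  "continuously_differentiable_on D f \<longleftrightarrow>
     (\<forall>x\<in>D. f differentiable at x) \<and> continuous_on D (grad f)"

definition lie_derivative ::
  "('a::euclidean_space \<Rightarrow> 'a) \<Rightarrow> ('a \<Rightarrow> real) \<Rightarrow> 'a \<Rightarrow> real" where
  "lie_derivative v f x = grad f x \<bullet> v x"

definition dual_point ::
  "(real ^ 'n \<Rightarrow> real ^ 'n) \<Rightarrow> real ^ 'n \<Rightarrow> dual ^ 'n" where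
  "dual_point v x = (\<chi> j. of_real (x $ j) + of_real (v x $ j) * eps)"

definition dual_lift :: "(real ^ 'n \<Rightarrow> real) \<Rightarrow> dual ^ 'n \<Rightarrow> dual" where
  "dual_lift f z =
     (let x = (\<chi> j. re_part (z $ j)); w = (\<chi> j. eps_part (z $ j))
      in of_real (f x) + of_real (grad f x \<bullet> w) * eps)"


section \<open>Clarke generalized gradient\<close>

definition closed_convex_hull :: "'a::real_normed_vector set \<Rightarrow> 'a set" where
  "closed_convex_hull S = closure (convex hull S)"

definition clarke_gradient ::
  "'a::euclidean_space set \<Rightarrow> ('a \<Rightarrow> real) \<Rightarrow> 'a \<Rightarrow> 'a set" where
  "clarke_gradient D f x = closed_convex_hull
     {w. \<exists>X. (\<forall>k. X k \<in> D - {y \<in> D. \<not> f differentiable at y}) \<and>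
             X \<longlonglongrightarrow> x \<and> (\<lambda>k. grad f (X k)) \<longlonglongrightarrow> w}"

end

theory Submission
  imports Defs
begin

text \<open>
  The function \<open>h\<close> is a continuous selection of the \<open>hs i\<close>, and membership in a closed convex
  hull is tested direction by direction. Every direction \<open>d\<close> has an index that is selected at points
  \<open>x + t *\<^sub>R d\<close> with \<open>t > 0\<close> arbitrarily small; comparing difference quotients along them gives the
  inclusion for the Clarke gradient. For the reverse membership, Rademacher's theorem is not needed:
  on a dense open set \<open>h\<close> coincides locally with some \<open>hs i\<close>, so the indices whose regions of
  coincidence accumulate at \<open>x\<close> contribute their gradients to the Clarke gradient, and these indices
  already suffice to select \<open>h\<close> near \<open>x\<close>.
\<close>

section \<open>Composite functions as selections\<close>

lemma dual_eval_eq_selected: "dual_eval \<Phi> z = z $ selected_index \<Phi> z"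
  by (induction \<Phi>) (auto simp: min_re_def max_re_def)

text \<open>The tests in \<open>min_re\<close> and \<open>max_re\<close> see real parts only, so
  taking real parts commutes with every node.\<close>

lemma re_part_dual_eval: "re_part (dual_eval \<Phi> z) = fcomp_eval \<Phi> (\<chi> i. re_part (z $ i))"
  by (induction \<Phi>) (auto simp: min_re_def max_re_def)

lemma fcomp_eval_selects: "\<exists>i. fcomp_eval \<Phi> y = y $ i"
  by (induction \<Phi>) (metis fcomp_eval.simps min_def max_def)+

lemma continuous_on_fcomp_eval:
  assumes "\<And>i. continuous_on S (f i)"
  shows "continuous_on S (\<lambda>y. fcomp_eval \<Phi> (\<chi> i. f i y))"
  by (induction \<Phi>) (auto intro!: continuous_on_min continuous_on_max assms)

text \<open>A composition of minima lies below each of its leaves, and selection always ends at a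
  leaf. Hence \<open>z\<close> need not be related to \<open>y\<close>: an index selected at one
  point bounds the function everywhere.\<close>

lemma min_only_le_selected: "min_only \<Phi> \<Longrightarrow> fcomp_eval \<Phi> y \<le> y $ selected_index \<Phi> z"
  by (induction \<Phi>) (auto simp: min_le_iff_disj)

lemma max_only_ge_selected: "max_only \<Phi> \<Longrightarrow> y $ selected_index \<Phi> z \<le> fcomp_eval \<Phi> y"
  by (induction \<Phi>) (auto simp: le_max_iff_disj)

lemma dual_lift_dual_point:
  "dual_lift f (dual_point v x) = of_real (f x) + of_real (lie_derivative v f x) * eps"
  by (simp add: dual_lift_def dual_point_def lie_derivative_def dual_eq_iff)

section \<open>Limits along frequently selected indices\<close>

text \<open>Pigeonhole along a filter; it stands in for passing to a subsequence on which the index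
  is constant.\<close>

lemma frequently_bex_finite:
  assumes "finite I" "F \<noteq> bot" "\<forall>\<^sub>F t in F. \<exists>i\<in>I. P i t"
  obtains i where "i \<in> I" "\<exists>\<^sub>F t in F. P i t"
proof -
  have "\<exists>i\<in>I. \<exists>\<^sub>F t in F. P i t"
  proof (rule ccontr)
    assume "\<not> ?thesis"
    then have "\<forall>\<^sub>F t in F. \<forall>i\<in>I. \<not> P i t"
      using assms(1) by (intro eventually_ball_finite) (auto simp: frequently_def)
    with assms(3) have "\<forall>\<^sub>F t in F. False"
      by eventually_elim auto
    with assms(2) show False
      by simp
  qed
  with that show thesis by blast
qed

text \<open>Since both limits exist, \<open>m < l\<close> would separate the two functions
  eventually, so comparing them frequently is enough.\<close>

lemma tendsto_le_frequently:
  fixes f g :: "'a \<Rightarrow> real"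
  assumes "(f \<longlongrightarrow> l) F" "(g \<longlongrightarrow> m) F" "\<exists>\<^sub>F t in F. f t \<le> g t"
  shows "l \<le> m"
proof (rule ccontr)
  assume "\<not> l \<le> m"
  then obtain c where "m < c" "c < l"
    using dense by (metis not_le)
  then have "\<forall>\<^sub>F t in F. c < f t" "\<forall>\<^sub>F t in F. g t < c"
    using assms(1,2) by (auto dest: order_tendstoD)
  then have "\<forall>\<^sub>F t in F. \<not> f t \<le> g t"
    by eventually_elim auto
  with assms(3) show False
    by (simp add: frequently_def)
qed

lemma tendsto_eq_frequently:
  fixes f g :: "'a \<Rightarrow> real"
  assumes "(f \<longlongrightarrow> l) F" "(g \<longlongrightarrow> m) F" "\<exists>\<^sub>F t in F. f t = g t"
  shows "l = m"
proof (rule antisym)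
  have "\<exists>\<^sub>F t in F. f t \<le> g t" "\<exists>\<^sub>F t in F. g t \<le> f t"
    using assms(3) by (auto elim: frequently_elim1)
  then show "l \<le> m" "m \<le> l"
    using assms(1,2) by (auto intro: tendsto_le_frequently)
qed

lemma tendsto_ray:
  fixes x d :: "'a::real_normed_vector"
  shows "((\<lambda>t. x + t *\<^sub>R d) \<longlongrightarrow> x) (at_right 0)"
proof -
  have "((\<lambda>t. x + t *\<^sub>R d) \<longlongrightarrow> x + 0 *\<^sub>R d) (at_right 0)"
    by (intro tendsto_intros)
  then show ?thesis by simp
qed

lemma GDERIV_difference_quotient:
  assumes "GDERIV f x :> g"
  shows "((\<lambda>t. (f (x + t *\<^sub>R d) - f x) / t) \<longlongrightarrow> d \<bullet> g) (at_right 0)"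
proof -
  have "((\<lambda>t. x + t *\<^sub>R d) has_derivative (\<lambda>t. t *\<^sub>R d)) (at 0)"
    by (auto intro!: derivative_eq_intros)
  moreover have "(f has_derivative (\<lambda>h. h \<bullet> g)) (at (x + 0 *\<^sub>R d))"
    using assms by (simp add: gderiv_def)
  ultimately have "((\<lambda>t. f (x + t *\<^sub>R d)) has_derivative (\<lambda>t. (t *\<^sub>R d) \<bullet> g)) (at 0)"
    by (rule has_derivative_compose)
  then have "((\<lambda>t. f (x + t *\<^sub>R d)) has_real_derivative d \<bullet> g) (at 0)"
    by (simp add: has_field_derivative_def mult.commute[of _ "d \<bullet> g"])
  then have "((\<lambda>t. (f (x + t *\<^sub>R d) - f x) / t) \<longlongrightarrow> d \<bullet> g) (at 0)"
    by (simp add: DERIV_def)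
  then show ?thesis
    by (rule filterlim_mono) (auto simp: at_within_le_at)
qed

text \<open>Equal values at \<open>x\<close> turn the comparison of \<open>f\<close> and
  \<open>g\<close> into one of difference quotients, whose limits are the directional
  derivatives.\<close>

lemma GDERIV_dir_le:
  fixes f g :: "'a::euclidean_space \<Rightarrow> real"
  assumes "GDERIV f x :> a" "GDERIV g x :> b" "f x = g x"
    and "\<exists>\<^sub>F t in at_right 0. f (x + t *\<^sub>R d) \<le> g (x + t *\<^sub>R d)"
  shows "d \<bullet> a \<le> d \<bullet> b"
proof (rule tendsto_le_frequently)
  have "\<forall>\<^sub>F t in at_right (0::real). t > 0"
    by (rule eventually_at_right_less)
  with assms(4) have "\<exists>\<^sub>F t in at_right 0. f (x + t *\<^sub>R d) \<le> g (x + t *\<^sub>R d) \<and> t > 0"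
    by (rule frequently_eventually_frequently)
  then show "\<exists>\<^sub>F t in at_right 0. (f (x + t *\<^sub>R d) - f x) / t \<le> (g (x + t *\<^sub>R d) - g x) / t"
    by (rule frequently_elim1) (auto simp: assms(3) divide_right_mono)
qed (fact GDERIV_difference_quotient[OF assms(1)] GDERIV_difference_quotient[OF assms(2)])+

lemma in_closed_convex_hull_directional:
  fixes w :: "'a::euclidean_space"
  assumes "\<And>d. \<exists>s\<in>S. d \<bullet> w \<le> d \<bullet> s"
  shows "w \<in> closed_convex_hull S"
proof (rule ccontr)
  assume "w \<notin> closed_convex_hull S"
  then obtain a b where ab: "a \<bullet> w < b" "\<forall>s\<in>closed_convex_hull S. a \<bullet> s > b"
    using separating_hyperplane_closed_point[of "closed_convex_hull S" w]
    by (auto simp: closed_convex_hull_def convex_closure)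
  \<comment> \<open>The separating hyperplane has \<open>w\<close> on its lower side, so the
    direction that contradicts the assumption is \<open>- a\<close>.\<close>
  obtain s where s: "s \<in> S" "(- a) \<bullet> w \<le> (- a) \<bullet> s"
    using assms by blast
  then have "s \<in> closed_convex_hull S"
    using closure_subset hull_subset unfolding closed_convex_hull_def by fast
  with ab s(2) show False by fastforce
qed

lemma subset_closed_convex_hull: "S \<subseteq> closed_convex_hull S"
  unfolding closed_convex_hull_def using closure_subset hull_subset by fast

section \<open>Continuous selections of finitely many differentiable functions\<close>

text \<open>Abstracts from the expression tree: what the analysis uses of \<open>h\<close> is its
  continuity and its pointwise agreement with some \<open>f i\<close>.\<close>

locale continuous_selection =
  fixes D :: "'a::euclidean_space set" and f :: "'i::finite \<Rightarrow> 'a \<Rightarrow> real" and h :: "'a \<Rightarrow> real"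
  assumes open_D: "open D"
    and cdiff: "continuously_differentiable_on D (f i)"
    and cont_h: "continuous_on D h"
    and selects: "y \<in> D \<Longrightarrow> \<exists>i. h y = f i y"
begin

lemma differentiable_f: "y \<in> D \<Longrightarrow> f i differentiable at y"
  using cdiff[of i] by (simp add: continuously_differentiable_on_def)

lemma GDERIV_f: "y \<in> D \<Longrightarrow> GDERIV (f i) y :> grad (f i) y"
  by (intro differentiable_imp_GDERIV_grad differentiable_f)

lemma isCont_f: "y \<in> D \<Longrightarrow> isCont (f i) y"
  by (intro differentiable_imp_continuous_within differentiable_f)

lemma isCont_h: "y \<in> D \<Longrightarrow> isCont h y"
  using cont_h continuous_on_eq_continuous_at[OF open_D] by blast

lemma isCont_grad: "y \<in> D \<Longrightarrow> isCont (grad (f i)) y"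
  using cdiff[of i] continuous_on_eq_continuous_at[OF open_D]
  unfolding continuously_differentiable_on_def by blast

lemma frequently_selected_limit:
  assumes "y \<in> D" "(g \<longlongrightarrow> y) F" "\<exists>\<^sub>F t in F. h (g t) = f i (g t)"
  shows "h y = f i y"
  using assms isCont_h isCont_f
  by (intro tendsto_eq_frequently[of "\<lambda>t. h (g t)" _ F "\<lambda>t. f i (g t)"]) (auto intro: isCont_tendsto_compose)

text \<open>The index set \<open>I\<close> is a parameter because the lemma serves twice: with all
  indices, and with those whose regions accumulate at the point.\<close>

lemma direction_selected:
  assumes "y \<in> D" "\<forall>\<^sub>F u in nhds y. \<exists>i\<in>I. h u = f i u"
  obtains i where "i \<in> I" "h y = f i y" "\<exists>\<^sub>F t in at_right 0. h (y + t *\<^sub>R d) = f i (y + t *\<^sub>R d)"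
proof -
  have "\<forall>\<^sub>F t in at_right 0. \<exists>i\<in>I. h (y + t *\<^sub>R d) = f i (y + t *\<^sub>R d)"
    using eventually_compose_filterlim[OF assms(2) tendsto_ray] .
  then obtain i where i: "i \<in> I" "\<exists>\<^sub>F t in at_right 0. h (y + t *\<^sub>R d) = f i (y + t *\<^sub>R d)"
    by (rule frequently_bex_finite[rotated 2]) auto
  with that frequently_selected_limit[OF assms(1) tendsto_ray i(2)] show thesis
    by blast
qed

lemma eventually_selects: "y \<in> D \<Longrightarrow> \<forall>\<^sub>F u in nhds y. \<exists>i\<in>UNIV. h u = f i u"
  using eventually_nhds_in_open[OF open_D] by (rule eventually_mono) (auto dest: selects)

text \<open>The index may depend on \<open>d\<close>. Agreement of the derivatives in the one
  direction \<open>d\<close> is all that the directional test for the hull asks for.\<close>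

lemma grad_direction:
  assumes "y \<in> D" "h differentiable at y"
  shows "\<exists>i. h y = f i y \<and> d \<bullet> grad h y = d \<bullet> grad (f i) y"
proof -
  obtain i where i: "h y = f i y" "\<exists>\<^sub>F t in at_right 0. h (y + t *\<^sub>R d) = f i (y + t *\<^sub>R d)"
    using direction_selected[OF assms(1) eventually_selects[OF assms(1)]] by blast
  have "GDERIV h y :> grad h y"
    using assms(2) by (rule differentiable_imp_GDERIV_grad)
  moreover have "\<exists>\<^sub>F t in at_right 0. h (y + t *\<^sub>R d) \<le> f i (y + t *\<^sub>R d)"
    "\<exists>\<^sub>F t in at_right 0. f i (y + t *\<^sub>R d) \<le> h (y + t *\<^sub>R d)"
    using i(2) by (auto elim: frequently_elim1)
  ultimately have "d \<bullet> grad h y = d \<bullet> grad (f i) y"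
    using i(1) GDERIV_f[OF assms(1)] by (intro antisym GDERIV_dir_le[of h] GDERIV_dir_le[of "f i"]) simp_all
  with i(1) show ?thesis
    by blast
qed

section \<open>Clarke gradient inside the hull of the active gradients\<close>

lemma clarke_gradient_subset:
  assumes x: "x \<in> D"
  shows "clarke_gradient D h x \<subseteq> closed_convex_hull {grad (f i) x | i. f i x = h x}" (is "_ \<subseteq> ?C")
proof -
  have "w \<in> ?C"
    if X: "\<forall>k. X k \<in> D - {y \<in> D. \<not> h differentiable at y}" "X \<longlonglongrightarrow> x"
      and w: "(\<lambda>k. grad h (X k)) \<longlonglongrightarrow> w" for w X
  proof (rule in_closed_convex_hull_directional)
    fix d
    have "\<forall>\<^sub>F k in sequentially. \<exists>i\<in>UNIV. h (X k) = f i (X k) \<and>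
        d \<bullet> grad h (X k) = d \<bullet> grad (f i) (X k)"
      using X(1) grad_direction by auto
    \<comment> \<open>The index varies with \<open>k\<close>, but one index recurs for infinitely
      many \<open>k\<close>; the limits along the whole sequence can be compared through it.\<close>
    then obtain i where i: "\<exists>\<^sub>F k in sequentially. h (X k) = f i (X k) \<and>
        d \<bullet> grad h (X k) = d \<bullet> grad (f i) (X k)"
      by (rule frequently_bex_finite[rotated 2]) auto
    have "h x = f i x"
      using i by (intro frequently_selected_limit[OF x X(2)]) (auto elim: frequently_elim1)
    moreover have "d \<bullet> w = d \<bullet> grad (f i) x"
    proof (rule tendsto_eq_frequently)
      show "(\<lambda>k. d \<bullet> grad h (X k)) \<longlonglongrightarrow> d \<bullet> w"
        using w by (intro tendsto_intros)
      show "(\<lambda>k. d \<bullet> grad (f i) (X k)) \<longlonglongrightarrow> d \<bullet> grad (f i) x"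
        using isCont_tendsto_compose[OF isCont_grad[OF x] X(2)] by (intro tendsto_intros)
      show "\<exists>\<^sub>F k in sequentially. d \<bullet> grad h (X k) = d \<bullet> grad (f i) (X k)"
        using i by (rule frequently_elim1) auto
    qed
    ultimately show "\<exists>s\<in>{grad (f i) x | i. f i x = h x}. d \<bullet> w \<le> d \<bullet> s"
      by (intro bexI[of _ "grad (f i) x"]) auto
  qed
  then show ?thesis
    unfolding clarke_gradient_def closed_convex_hull_def[of "Collect _"]
    by (intro closure_minimal hull_minimal) (auto simp: closed_convex_hull_def convex_closure)
qed

section \<open>Open regions of coincidence and their gradients\<close>

definition region :: "'i \<Rightarrow> 'a set" where
  "region i = interior {y \<in> D. h y = f i y}"

lemma region_subset: "region i \<subseteq> D"
  and region_eq: "y \<in> region i \<Longrightarrow> h y = f i y"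
  using interior_subset[of "{y \<in> D. h y = f i y}"] by (auto simp: region_def)

text \<open>
  At a point of \<open>W\<close> where the number of active indices is minimal, the active set is locally
  constant, since inactive indices stay inactive nearby.
\<close>

lemma regions_dense:
  assumes "open W" "W \<subseteq> D" "W \<noteq> {}"
  shows "\<exists>i. W \<inter> region i \<noteq> {}"
proof -
  define act where "act y = {i. h y = f i y}" for y
  obtain y where y: "y \<in> W" "\<And>u. u \<in> W \<Longrightarrow> card (act y) \<le> card (act u)"
    using ex_has_least_nat[of "\<lambda>u. u \<in> W" _ "\<lambda>u. card (act u)"] assms(3) by blast
  then have "y \<in> D" using assms(2) by blast
  then obtain i where i: "i \<in> act y"
    using selects by (auto simp: act_def)
  have "\<forall>\<^sub>F u in nhds y. \<forall>j\<in>- act y. h u \<noteq> f j u"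
  proof (intro eventually_ball_finite ballI)
    fix j assume "j \<in> - act y"
    then have "h y - f j y \<noteq> 0" by (simp add: act_def)
    moreover have "((\<lambda>u. h u - f j u) \<longlongrightarrow> h y - f j y) (nhds y)"
      using isCont_h[OF \<open>y \<in> D\<close>] isCont_f[OF \<open>y \<in> D\<close>]
      by (intro tendsto_intros) (auto simp: continuous_at tendsto_at_iff_tendsto_nhds)
    ultimately have "\<forall>\<^sub>F u in nhds y. h u - f j u \<noteq> 0"
      by (rule tendsto_imp_eventually_ne[rotated])
    then show "\<forall>\<^sub>F u in nhds y. h u \<noteq> f j u"
      by eventually_elim simp
  qed simp
  moreover have "\<forall>\<^sub>F u in nhds y. u \<in> W"
    using assms(1) y(1) by (rule eventually_nhds_in_open)
  ultimately have "\<forall>\<^sub>F u in nhds y. u \<in> D \<and> h u = f i u"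
  proof eventually_elim
    case (elim u)
    then have "act u \<subseteq> act y" by (auto simp: act_def)
    then have "act u = act y"
      using y(2)[OF elim(2)] by (intro card_seteq) auto
    with i elim(2) assms(2) show ?case by (auto simp: act_def)
  qed
  then have "y \<in> region i"
    by (auto simp: region_def interior_def eventually_nhds)
  with y(1) show ?thesis by blast
qed

lemma GDERIV_h_region:
  assumes "y \<in> region i"
  shows "GDERIV h y :> grad (f i) y"
proof -
  have "\<forall>\<^sub>F u in nhds y. u \<in> region i"
    using assms by (intro eventually_nhds_in_open) (auto simp: region_def)
  then have ev: "\<forall>\<^sub>F u in at y. f i u = h u"
    by (auto simp: eventually_at_filter region_eq elim!: eventually_mono)
  have "y \<in> D" using assms region_subset by blast
  then have "(f i has_derivative (\<lambda>e. e \<bullet> grad (f i) y)) (at y)"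
    using GDERIV_f by (simp add: gderiv_def)
  then show ?thesis
    unfolding gderiv_def
    by (rule has_derivative_transform_eventually[OF _ ev]) (auto simp: region_eq[OF assms])
qed

text \<open>A sequence in the region tending to \<open>x\<close> is admissible in the definition of
  the Clarke gradient, and continuity of \<open>grad (f i)\<close> identifies the limit of its
  gradients.\<close>

lemma grad_in_clarke_gradient_region:
  assumes x: "x \<in> D" "x \<in> closure (region i)"
  shows "grad (f i) x \<in> clarke_gradient D h x"
proof -
  obtain X where X: "\<And>k. X k \<in> region i" "X \<longlonglongrightarrow> x"
    using x(2) by (auto simp: closure_sequential)
  have g: "GDERIV h (X k) :> grad (f i) (X k)" for k
    using X(1) by (rule GDERIV_h_region)
  then have "h differentiable at (X k)" for k
    by (auto simp: gderiv_def differentiable_def)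
  moreover have "X k \<in> D" for k
    using X(1) region_subset by blast
  moreover have "(\<lambda>k. grad h (X k)) \<longlonglongrightarrow> grad (f i) x"
    using isCont_tendsto_compose[OF isCont_grad[OF x(1)] X(2)] by (simp add: GDERIV_imp_grad[OF g])
  ultimately show ?thesis
    unfolding clarke_gradient_def using X(2)
    by (intro subsetD[OF subset_closed_convex_hull]) auto
qed

text \<open>Near \<open>x\<close> the finitely many closures that miss \<open>x\<close> are avoided.
  By density each \<open>y\<close> in \<open>D\<close> still lies in the closure of some region, and
  continuity extends \<open>h = f i\<close> from the region to \<open>y\<close>.\<close>

lemma eventually_region_selects:
  assumes x: "x \<in> D"
  shows "\<forall>\<^sub>F y in nhds x. \<exists>i\<in>{i. x \<in> closure (region i)}. h y = f i y"
proof -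
  have "\<forall>\<^sub>F y in nhds x. \<forall>i\<in>{i. x \<notin> closure (region i)}. y \<in> - closure (region i)"
    by (intro eventually_ball_finite ballI eventually_nhds_in_open) auto
  moreover have "\<forall>\<^sub>F y in nhds x. y \<in> D"
    using open_D x by (rule eventually_nhds_in_open)
  ultimately show ?thesis
  proof eventually_elim
    case (elim y)
    have "\<exists>i. y \<in> closure (region i)"
    proof (rule ccontr)
      assume "\<not> ?thesis"
      then have "y \<in> D \<inter> - (\<Union>i. closure (region i))"
        using elim by blast
      moreover have "open (D \<inter> - (\<Union>i. closure (region i)))"
        using open_D by (intro open_Int open_Compl closed_UN) auto
      ultimately obtain i where "D \<inter> - (\<Union>i. closure (region i)) \<inter> region i \<noteq> {}"
        using regions_dense[of "D \<inter> - (\<Union>i. closure (region i))"] by blast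
      then show False
        using closure_subset by fastforce
    qed
    then obtain i where i: "y \<in> closure (region i)" by blast
    then obtain X where X: "\<And>k. X k \<in> region i" "X \<longlonglongrightarrow> y"
      by (auto simp: closure_sequential)
    have "h y = f i y"
      using elim X by (intro frequently_selected_limit[where g = X and F = sequentially])
        (auto simp: region_eq)
    moreover have "x \<in> closure (region i)"
      using elim i by blast
    ultimately show ?case by blast
  qed
qed

section \<open>Gradients of functions touching \<open>h\<close> from one side\<close>

lemma closed_convex_clarke_gradient:
  "closed (clarke_gradient D h x)" "convex (clarke_gradient D h x)"
  by (auto simp: clarke_gradient_def closed_convex_hull_def convex_closure)

text \<open>On each ray from \<open>x\<close>, \<open>h\<close> is frequently equal to some
  \<open>f i\<close> with \<open>i\<close> in \<open>?I\<close>, so the one-sided bound by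
  \<open>f j\<close> becomes an inequality between directional derivatives. The gradients for
  \<open>?I\<close> are already known to be Clarke gradients.\<close>

lemma grad_extremal_in_clarke_gradient:
  assumes x: "x \<in> D" "f j x = h x"
    and extremal: "(\<forall>y\<in>D. f j y \<le> h y) \<or> (\<forall>y\<in>D. h y \<le> f j y)"
  shows "grad (f j) x \<in> clarke_gradient D h x"
proof -
  let ?I = "{i. x \<in> closure (region i)}"
  have ray: "\<forall>\<^sub>F t in at_right 0. x + t *\<^sub>R d \<in> D" for d
    using eventually_compose_filterlim[OF eventually_nhds_in_open[OF open_D x(1)] tendsto_ray] .
  have "grad (f j) x \<in> closed_convex_hull ((\<lambda>i. grad (f i) x) ` ?I)"
  proof (rule in_closed_convex_hull_directional)
    fix d
    show "\<exists>s\<in>(\<lambda>i. grad (f i) x) ` ?I. d \<bullet> grad (f j) x \<le> d \<bullet> s"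
      using extremal
    proof
      assume ge: "\<forall>y\<in>D. f j y \<le> h y"
      obtain i where i: "i \<in> ?I" "h x = f i x"
        "\<exists>\<^sub>F t in at_right 0. h (x + t *\<^sub>R d) = f i (x + t *\<^sub>R d)"
        using direction_selected[OF x(1) eventually_region_selects[OF x(1)]] by blast
      from frequently_eventually_frequently[OF i(3) ray[of d]]
      have "\<exists>\<^sub>F t in at_right 0. f j (x + t *\<^sub>R d) \<le> f i (x + t *\<^sub>R d)"
        by (rule frequently_elim1) (use ge in force)
      then have "d \<bullet> grad (f j) x \<le> d \<bullet> grad (f i) x"
        using x i(2) by (intro GDERIV_dir_le[OF GDERIV_f GDERIV_f]) auto
      with i(1) show ?thesis by blast
    next
      \<comment> \<open>Along \<open>d\<close> the bound from above would give the wrong inequality;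
        the ray in direction \<open>- d\<close> reverses it.\<close>
      assume le: "\<forall>y\<in>D. h y \<le> f j y"
      obtain i where i: "i \<in> ?I" "h x = f i x"
        "\<exists>\<^sub>F t in at_right 0. h (x + t *\<^sub>R (- d)) = f i (x + t *\<^sub>R (- d))"
        using direction_selected[OF x(1) eventually_region_selects[OF x(1)]] by blast
      from frequently_eventually_frequently[OF i(3) ray[of "- d"]]
      have "\<exists>\<^sub>F t in at_right 0. f i (x + t *\<^sub>R (- d)) \<le> f j (x + t *\<^sub>R (- d))"
        by (rule frequently_elim1) (use le in force)
      then have "(- d) \<bullet> grad (f i) x \<le> (- d) \<bullet> grad (f j) x"
        using x i(2) by (intro GDERIV_dir_le[OF GDERIV_f GDERIV_f]) auto
      with i(1) show ?thesis by auto
    qed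
  qed
  also have "\<dots> \<subseteq> clarke_gradient D h x"
    unfolding closed_convex_hull_def
    using grad_in_clarke_gradient_region[OF x(1)] closed_convex_clarke_gradient
    by (intro closure_minimal hull_minimal) auto
  finally show ?thesis .
qed

end

section \<open>Application to composite functions and dual evaluation\<close>

theorem theorem4:
  fixes D :: "(real ^ 'n) set"
    and x :: "real ^ 'n"
    and v :: "real ^ 'n \<Rightarrow> real ^ 'n"
    and hs :: "'p::finite \<Rightarrow> real ^ 'n \<Rightarrow> real"
    and \<Phi> :: "'p fcomp"
    and h :: "real ^ 'n \<Rightarrow> real"
    and z :: "dual ^ 'p"
    and i_star :: 'p
    and A :: "'p set"
  assumes "open D"
    and "x \<in> D"
    and "continuous_on D v"
    and "\<And>i. continuously_differentiable_on D (hs i)"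
    and h: "\<And>y. y \<in> D \<Longrightarrow> h y = fcomp_eval \<Phi> (\<chi> i. hs i y)"
    and z: "z = (\<chi> i. dual_lift (hs i) (dual_point v x))"
    and i_star: "i_star = selected_index \<Phi> z"
    and A: "A = {i. hs i x = h x}"
  shows "dual_eval \<Phi> z = of_real (h x) + of_real (lie_derivative v (hs i_star) x) * eps \<and>
    grad (hs i_star) x \<in> closed_convex_hull {grad (hs i) x | i. i \<in> A} \<and>
    clarke_gradient D h x \<subseteq> closed_convex_hull {grad (hs i) x | i. i \<in> A} \<and>
    (min_only \<Phi> \<or> max_only \<Phi> \<longrightarrow> grad (hs i_star) x \<in> clarke_gradient D h x)"
proof -
  have cont: "continuous_on D (hs i)" for i
    using assms(4)[of i] by (intro differentiable_imp_continuous_on)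
      (auto simp: continuously_differentiable_on_def differentiable_on_def intro: differentiable_at_withinI)
  interpret continuous_selection D hs h
  proof
    show "continuous_on D h"
      using continuous_on_fcomp_eval[OF cont] h by (simp cong: continuous_on_cong)
    show "\<exists>i. h y = hs i y" if "y \<in> D" for y
      using fcomp_eval_selects[of \<Phi> "\<chi> i. hs i y"] h[OF that] by auto
  qed (fact assms)+
  have z_nth: "z $ i = of_real (hs i x) + of_real (lie_derivative v (hs i) x) * eps" for i
    by (simp add: z dual_lift_dual_point)
  have dual: "dual_eval \<Phi> z = z $ i_star"
    by (simp add: dual_eval_eq_selected i_star)
  \<comment> \<open>The real part is computed twice, from the selected component and by ordinary
    evaluation, which shows that the selected index is active.\<close>
  have "hs i_star x = re_part (dual_eval \<Phi> z)"
    by (simp add: dual z_nth)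
  also have "\<dots> = h x"
    by (simp add: re_part_dual_eval z_nth h[OF assms(2)])
  finally have active: "hs i_star x = h x" .
  have "grad (hs i_star) x \<in> closed_convex_hull {grad (hs i) x | i. i \<in> A}"
    using active A by (intro subsetD[OF subset_closed_convex_hull]) blast
  moreover have "grad (hs i_star) x \<in> clarke_gradient D h x" if "min_only \<Phi> \<or> max_only \<Phi>"
  proof (rule grad_extremal_in_clarke_gradient[OF assms(2) active])
    have "min_only \<Phi> \<Longrightarrow> h y \<le> hs i_star y" "max_only \<Phi> \<Longrightarrow> hs i_star y \<le> h y" if "y \<in> D" for y
      using min_only_le_selected[of \<Phi> "\<chi> i. hs i y" z] max_only_ge_selected[of \<Phi> "\<chi> i. hs i y" z]
      by (simp_all add: h[OF that] i_star)
    with that show "(\<forall>y\<in>D. hs i_star y \<le> h y) \<or> (\<forall>y\<in>D. h y \<le> hs i_star y)"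
      by blast
  qed
  ultimately show ?thesis
    using clarke_gradient_subset[OF assms(2)] by (simp add: dual z_nth active A)
qed

end
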